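(* The tableau calculus $\mathbf{TAB}+Dec$ is sound for the class of decreasing d-product frames: for every formula $\varphi$, if $\varphi$ is provable in $\mathbf{TAB}+Dec$, then $\varphi$ holds at every point of every d-product model whose frame is decreasing.
   Context: **Language.** Fix a countable set $\mathbf{Prop}$ of propositional variables and two disjoint countably infinite sets $\mathbf{Nom}_1$, $\mathbf{Nom}_2$ of nominals, disjoint from $\mathbf{Prop}$; $\mathbf{Nom}=\mathbf{Nom}_1\cup\mathbf{Nom}_2$. Letters $i,j,k$ range over $\mathbf{Nom}_1$ and $a,b,c$ over $\mathbf{Nom}_2$. Formulas: $\varphi ::= p \mid i \mid a \mid \neg\varphi \mid \varphi\land\varphi \mid \diamondsuit_1\varphi \mid \diamondsuit_2\varphi \mid @_i\varphi \mid @_a\varphi$ with $p\in\mathbf{Prop}$. **Semantics.** Given a Kripke frame $(W_1,R_1)$ ($W_1$ non-empty countable, $R_1\subseteq W_1\times W_1$) and a multi-modal Kripke frame $(W_2,(R_2(x))_{x\in W_1})$ ($W_2$ non-empty countable, each $R_2(x)\subseteq W_2\times W_2$), the dependent product frame (d-product frame) is $(W,R_h,R_v)$ with $W=W_1\times W_2$; $(x,y)R_h(x',y')$ iff $xR_1x'$ and $y=y'$; $(x,y)R_v(x',y')$ iff $x=x'$ and $yR_2(x)y'$. It is decreasing if for all $x,x'\in W_1$, $xR_1x'$ implies $R_2(x)\supseteq R_2(x')$. A d-product model $\mathfrak M=(\mathfrak F,V)$ is a d-product frame with $V:\mathbf{Prop}\cup\mathbf{Nom}\to\mathcal P(W)$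 such that $V(i)=\{x\}\times W_2$ for some $x\in W_1$ (denoted $i^V$) and $V(a)=W_1\times\{y\}$ for some $y\in W_2$ (denoted $a^V$). Satisfaction: $\mathfrak M,(x,y)\models p$ iff $(x,y)\in V(p)$; $\models i$ iff $x=i^V$; $\models a$ iff $y=a^V$; $\neg,\land$ as usual; $\models\diamondsuit_1\varphi$ (resp. $\diamondsuit_2\varphi$) iff $\varphi$ holds at some $R_h$-successor (resp. $R_v$-successor) of $(x,y)$; $\mathfrak M,(x,y)\models @_i\varphi$ iff $\mathfrak M,(i^V,y)\models\varphi$; $\mathfrak M,(x,y)\models @_a\varphi$ iff $\mathfrak M,(x,a^V)\models\varphi$. **Tableau calculus $\mathbf{TAB}+Dec$** (the HdPL tableau calculus with the rule $[Dec]$). A tableau is a well-founded tree (each node is reached from the root in finitely many steps; branches may be infinite) constructed as follows. Start with a root formula of the form $@_i@_a\neg\varphi$, where $i,a$ do not occur in $\varphi$. Extend each branch by applying the rules below to all nodes as often as possible; no formula can be added to a branch any more if every new formula generated by applying an arbitrary rule already exists in the branch, or if the branch is closed. A branch is a maximal path; $\varphi\in\Theta$ means $\varphi$ occurs in the branch $\Theta$. Rules (premises / formulas added; "$\mid$" means the branch splits): - $[\neg\neg]$: $@_i@_a\neg\neg\varphi\ /\ @_i@_a\varphi$. - $[\land]$: $@_i@_a(\varphi\land\psi)\ /\ @_i@_a\varphi,\ @_i@_a\psi$. - $[\neg\land]$: $@_i@_a\neg(\varphi\land\psi)\ /\ @_i@_a\neg\varphi\mid @_i@_a\neg\psi$.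 - $[\diamondsuit_1]$: $@_i@_a\diamondsuit_1\varphi\ /\ @_i\diamondsuit_1 j,\ @_j@_a\varphi$, where $j\in\mathbf{Nom}_1$ does not occur in the branch; applied only once per formula. The added formula $@_i\diamondsuit_1 j$ counts as an accessibility formula. - $[\diamondsuit_2^d]$: $@_i@_a\diamondsuit_2\varphi\ /\ @_i@_a\diamondsuit_2 b,\ @_i@_b\varphi$, where $b\in\mathbf{Nom}_2$ does not occur in the branch; applied only once per formula. The added formula $@_i@_a\diamondsuit_2 b$, containing the new nominal $b$, is called an accessibility formula. - $[\neg\diamondsuit_1]$: $@_i@_a\neg\diamondsuit_1\varphi,\ @_i\diamondsuit_1 j\ /\ @_j@_a\neg\varphi$. - $[\neg\diamondsuit_2^d]$: $@_i@_a\neg\diamondsuit_2\varphi,\ @_i@_a\diamondsuit_2 b\ /\ @_i@_b\neg\varphi$. - $[@_1]$: $@_i@_a@_j\varphi\ /\ @_j@_a\varphi$. $[@_2]$: $@_i@_a@_b\varphi\ /\ @_i@_b\varphi$. - $[\neg@_1]$: $@_i@_a\neg@_j\varphi\ /\ @_j@_a\neg\varphi$. $[\neg@_2]$: $@_i@_a\neg@_b\varphi\ /\ @_i@_b\neg\varphi$. - $[Red_1]$: $@_i@_as\ /\ @_is$. $[Red_2]$: $@_i@_at\ /\ @_at$. - $[\neg_1]$: $@_i\neg j\ /\ @_jj$. $[\neg_2]$: $@_a\neg b\ /\ @_bb$. - $[Id_1]$: $@_i@_a\varphi,\ @_ij\ /\ @_j@_a\varphi$. $[Id_2]$: $@_i@_a\varphi,\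 @_ab\ /\ @_i@_b\varphi$. - $[Id'_1]$: $@_is,\ @_ij\ /\ @_js$. $[Id'_2]$: $@_at,\ @_ab\ /\ @_bt$. - $[Dec]$: $@_j@_a\diamondsuit_2 b,\ @_i\diamondsuit_1 j\ /\ @_i@_a\diamondsuit_2 b$, where the premises are required to be accessibility formulas and the conclusion is again an accessibility formula. In $Red_1,Id'_1$: $s=k$ or $\neg k$ with $k\in\mathbf{Nom}_1$; in $Red_2,Id'_2$: $t=c$ or $\neg c$ with $c\in\mathbf{Nom}_2$. Restriction: when applying $[\diamondsuit_2^d]$, $[Id_1]$ or $[Id_2]$, none of the premises may be an accessibility formula. A branch $\Theta$ is closed if for some $\varphi,i,a$: $@_i@_a\varphi,@_i@_a\neg\varphi\in\Theta$, or $@_i\varphi,@_i\neg\varphi\in\Theta$, or $@_a\varphi,@_a\neg\varphi\in\Theta$; otherwise open. A tableau is closed if all its branches are closed. $\varphi$ is provable iff there is a closed tableau whose root formula is $@_i@_a\neg\varphi$, with $i\in\mathbf{Nom}_1$, $a\in\mathbf{Nom}_2$ not occurring in $\varphi$. *)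

theory Defs
  imports
    Main
    "HOL-Library.Countable_Set"
    "HOL-Library.Infinite_Typeclass"
begin

section \<open>Formulas\<close>

text \<open>The type parameters are the propositional variables and the two sorts of nominals.\<close>

datatype (props: 'p, noms1: 'i, noms2: 'a) fm =
    Prop 'p
  | Nom1 'i
  | Nom2 'a
  | Neg "('p, 'i, 'a) fm"
  | And "('p, 'i, 'a) fm" "('p, 'i, 'a) fm"
  | Dia1 "('p, 'i, 'a) fm"
  | Dia2 "('p, 'i, 'a) fm"
  | At1 'i "('p, 'i, 'a) fm"
  | At2 'a "('p, 'i, 'a) fm"

abbreviation At :: "'i \<Rightarrow> 'a \<Rightarrow> ('p, 'i, 'a) fm \<Rightarrow> ('p, 'i, 'a) fm" where
  "At i a \<phi> \<equiv> At1 i (At2 a \<phi>)"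


section \<open>Dependent product frames and models\<close>

record ('w, 'v) dframe =
  worlds1 :: "'w set"
  worlds2 :: "'v set"
  rel1 :: "('w \<times> 'w) set"
  rel2 :: "'w \<Rightarrow> ('v \<times> 'v) set"

definition d_product_frame :: "('w, 'v, 'z) dframe_scheme \<Rightarrow> bool" where
  "d_product_frame F \<longleftrightarrow>
     worlds1 F \<noteq> {} \<and> countable (worlds1 F) \<and> rel1 F \<subseteq> worlds1 F \<times> worlds1 F \<and>
     worlds2 F \<noteq> {} \<and> countable (worlds2 F) \<and>
     (\<forall>x \<in> worlds1 F. rel2 F x \<subseteq> worlds2 F \<times> worlds2 F)"

definition points :: "('w, 'v, 'z) dframe_scheme \<Rightarrow> ('w \<times> 'v) set" where
  "points F = worlds1 F \<times> worlds2 F"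

definition rel_h :: "('w, 'v, 'z) dframe_scheme \<Rightarrow> (('w \<times> 'v) \<times> ('w \<times> 'v)) set" where
  "rel_h F = {((x, y), (x', y')).
     (x, y) \<in> points F \<and> (x', y') \<in> points F \<and> (x, x') \<in> rel1 F \<and> y = y'}"

definition rel_v :: "('w, 'v, 'z) dframe_scheme \<Rightarrow> (('w \<times> 'v) \<times> ('w \<times> 'v)) set" where
  "rel_v F = {((x, y), (x', y')).
     (x, y) \<in> points F \<and> (x', y') \<in> points F \<and> x = x' \<and> (y, y') \<in> rel2 F x}"

definition decreasing :: "('w, 'v, 'z) dframe_scheme \<Rightarrow> bool" where
  "decreasing F \<longleftrightarrow>
     (\<forall>x \<in> worlds1 F. \<forall>x' \<in> worlds1 F. (x, x') \<in> rel1 F \<longrightarrow> rel2 F x' \<subseteq> rel2 F x)"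

record ('p, 'i, 'a, 'w, 'v) dmodel = "('w, 'v) dframe" +
  val_prop :: "'p \<Rightarrow> ('w \<times> 'v) set"
  val_nom1 :: "'i \<Rightarrow> ('w \<times> 'v) set"
  val_nom2 :: "'a \<Rightarrow> ('w \<times> 'v) set"

definition d_product_model :: "('p, 'i, 'a, 'w, 'v) dmodel \<Rightarrow> bool" where
  "d_product_model M \<longleftrightarrow>
     d_product_frame M \<and>
     (\<forall>p. val_prop M p \<subseteq> points M) \<and>
     (\<forall>i. \<exists>x \<in> worlds1 M. val_nom1 M i = {x} \<times> worlds2 M) \<and>
     (\<forall>a. \<exists>y \<in> worlds2 M. val_nom2 M a = worlds1 M \<times> {y})"

definition den1 :: "('p, 'i, 'a, 'w, 'v) dmodel \<Rightarrow> 'i \<Rightarrow> 'w" where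
  "den1 M i = (THE x. x \<in> worlds1 M \<and> val_nom1 M i = {x} \<times> worlds2 M)"

definition den2 :: "('p, 'i, 'a, 'w, 'v) dmodel \<Rightarrow> 'a \<Rightarrow> 'v" where
  "den2 M a = (THE y. y \<in> worlds2 M \<and> val_nom2 M a = worlds1 M \<times> {y})"

primrec sat :: "('p, 'i, 'a, 'w, 'v) dmodel \<Rightarrow> 'w \<times> 'v \<Rightarrow> ('p, 'i, 'a) fm \<Rightarrow> bool" where
  "sat M w (Prop p) \<longleftrightarrow> w \<in> val_prop M p"
| "sat M w (Nom1 i) \<longleftrightarrow> fst w = den1 M i"
| "sat M w (Nom2 a) \<longleftrightarrow> snd w = den2 M a"
| "sat M w (Neg \<phi>) \<longleftrightarrow> \<not> sat M w \<phi>"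
| "sat M w (And \<phi> \<psi>) \<longleftrightarrow> sat M w \<phi> \<and> sat M w \<psi>"
| "sat M w (Dia1 \<phi>) \<longleftrightarrow> (\<exists>w'. (w, w') \<in> rel_h M \<and> sat M w' \<phi>)"
| "sat M w (Dia2 \<phi>) \<longleftrightarrow> (\<exists>w'. (w, w') \<in> rel_v M \<and> sat M w' \<phi>)"
| "sat M w (At1 i \<phi>) \<longleftrightarrow> sat M (den1 M i, snd w) \<phi>"
| "sat M w (At2 a \<phi>) \<longleftrightarrow> sat M (fst w, den2 M a) \<phi>"


section \<open>Branches and rules\<close>

text \<open>
  Whether a formula of a branch is an accessibility formula depends on how it was added, so a
  tableau node carries this information.  \<open>Witness \<psi> \<chi>\<close> is the accessibility formula \<open>\<psi>\<close> added
  by applying a diamond rule to \<open>\<chi>\<close>; remembering \<open>\<chi>\<close> expresses that diamond rules are applied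
  only once per formula.  \<open>Inherited \<psi>\<close> is an accessibility formula added by the rule \<open>Dec\<close>.
\<close>

datatype ('p, 'i, 'a) node =
    Plain "('p, 'i, 'a) fm"
  | Witness "('p, 'i, 'a) fm" "('p, 'i, 'a) fm"
  | Inherited "('p, 'i, 'a) fm"

primrec formula :: "('p, 'i, 'a) node \<Rightarrow> ('p, 'i, 'a) fm" where
  "formula (Plain \<psi>) = \<psi>"
| "formula (Witness \<psi> \<chi>) = \<psi>"
| "formula (Inherited \<psi>) = \<psi>"

primrec accessibility :: "('p, 'i, 'a) node \<Rightarrow> bool" where
  "accessibility (Plain \<psi>) = False"
| "accessibility (Witness \<psi> \<chi>) = True"
| "accessibility (Inherited \<psi>) = True"

definition forms :: "('p, 'i, 'a) node set \<Rightarrow> ('p, 'i, 'a) fm set" where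
  "forms \<Theta> = formula ` \<Theta>"

definition accs :: "('p, 'i, 'a) node set \<Rightarrow> ('p, 'i, 'a) fm set" where
  "accs \<Theta> = formula ` {n \<in> \<Theta>. accessibility n}"

definition dia_applied :: "('p, 'i, 'a) node set \<Rightarrow> ('p, 'i, 'a) fm \<Rightarrow> bool" where
  "dia_applied \<Theta> \<chi> \<longleftrightarrow> (\<exists>\<psi>. Witness \<psi> \<chi> \<in> \<Theta>)"

definition fresh1 :: "('p, 'i, 'a) node set \<Rightarrow> 'i \<Rightarrow> bool" where
  "fresh1 \<Theta> j \<longleftrightarrow> (\<forall>\<psi> \<in> forms \<Theta>. j \<notin> noms1 \<psi>)"

definition fresh2 :: "('p, 'i, 'a) node set \<Rightarrow> 'a \<Rightarrow> bool" where
  "fresh2 \<Theta> b \<longleftrightarrow> (\<forall>\<psi> \<in> forms \<Theta>. b \<notin> noms2 \<psi>)"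

definition nom1_literal :: "('p, 'i, 'a) fm \<Rightarrow> bool" where
  "nom1_literal s \<longleftrightarrow> (\<exists>k. s = Nom1 k \<or> s = Neg (Nom1 k))"

definition nom2_literal :: "('p, 'i, 'a) fm \<Rightarrow> bool" where
  "nom2_literal t \<longleftrightarrow> (\<exists>c. t = Nom2 c \<or> t = Neg (Nom2 c))"

text \<open>
  \<open>local_rule \<Theta> alts\<close>: some rule other than the diamond rules is applicable to premises in \<open>\<Theta>\<close>;
  the members of \<open>alts\<close> are the alternatives into which the branch splits, each given by the list
  of nodes to be added.
\<close>

inductive local_rule :: "('p, 'i, 'a) node set \<Rightarrow> ('p, 'i, 'a) node list list \<Rightarrow> bool"
  for \<Theta> :: "('p, 'i, 'a) node set" where
  NegNeg: "At i a (Neg (Neg \<phi>)) \<in> forms \<Theta> \<Longrightarrow> local_rule \<Theta> [[Plain (At i a \<phi>)]]"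
| Conj: "At i a (And \<phi> \<psi>) \<in> forms \<Theta> \<Longrightarrow>
    local_rule \<Theta> [[Plain (At i a \<phi>), Plain (At i a \<psi>)]]"
| NegConj: "At i a (Neg (And \<phi> \<psi>)) \<in> forms \<Theta> \<Longrightarrow>
    local_rule \<Theta> [[Plain (At i a (Neg \<phi>))], [Plain (At i a (Neg \<psi>))]]"
| NegDia1: "At i a (Neg (Dia1 \<phi>)) \<in> forms \<Theta> \<Longrightarrow> At1 i (Dia1 (Nom1 j)) \<in> forms \<Theta> \<Longrightarrow>
    local_rule \<Theta> [[Plain (At j a (Neg \<phi>))]]"
| NegDia2: "At i a (Neg (Dia2 \<phi>)) \<in> forms \<Theta> \<Longrightarrow> At i a (Dia2 (Nom2 b)) \<in> forms \<Theta> \<Longrightarrow>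
    local_rule \<Theta> [[Plain (At i b (Neg \<phi>))]]"
| Sat1: "At i a (At1 j \<phi>) \<in> forms \<Theta> \<Longrightarrow> local_rule \<Theta> [[Plain (At j a \<phi>)]]"
| Sat2: "At i a (At2 b \<phi>) \<in> forms \<Theta> \<Longrightarrow> local_rule \<Theta> [[Plain (At i b \<phi>)]]"
| NegSat1: "At i a (Neg (At1 j \<phi>)) \<in> forms \<Theta> \<Longrightarrow> local_rule \<Theta> [[Plain (At j a (Neg \<phi>))]]"
| NegSat2: "At i a (Neg (At2 b \<phi>)) \<in> forms \<Theta> \<Longrightarrow> local_rule \<Theta> [[Plain (At i b (Neg \<phi>))]]"
| Red1: "At i a s \<in> forms \<Theta> \<Longrightarrow> nom1_literal s \<Longrightarrow> local_rule \<Theta> [[Plain (At1 i s)]]"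
| Red2: "At i a t \<in> forms \<Theta> \<Longrightarrow> nom2_literal t \<Longrightarrow> local_rule \<Theta> [[Plain (At2 a t)]]"
| Neg1: "At1 i (Neg (Nom1 j)) \<in> forms \<Theta> \<Longrightarrow> local_rule \<Theta> [[Plain (At1 j (Nom1 j))]]"
| Neg2: "At2 a (Neg (Nom2 b)) \<in> forms \<Theta> \<Longrightarrow> local_rule \<Theta> [[Plain (At2 b (Nom2 b))]]"
| Id1: "At i a \<phi> \<in> forms \<Theta> - accs \<Theta> \<Longrightarrow> At1 i (Nom1 j) \<in> forms \<Theta> - accs \<Theta> \<Longrightarrow>
    local_rule \<Theta> [[Plain (At j a \<phi>)]]"
| Id2: "At i a \<phi> \<in> forms \<Theta> - accs \<Theta> \<Longrightarrow> At2 a (Nom2 b) \<in> forms \<Theta> - accs \<Theta> \<Longrightarrow>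
    local_rule \<Theta> [[Plain (At i b \<phi>)]]"
| Id1': "At1 i s \<in> forms \<Theta> \<Longrightarrow> nom1_literal s \<Longrightarrow> At1 i (Nom1 j) \<in> forms \<Theta> \<Longrightarrow>
    local_rule \<Theta> [[Plain (At1 j s)]]"
| Id2': "At2 a t \<in> forms \<Theta> \<Longrightarrow> nom2_literal t \<Longrightarrow> At2 a (Nom2 b) \<in> forms \<Theta> \<Longrightarrow>
    local_rule \<Theta> [[Plain (At2 b t)]]"
| Dec: "At j a (Dia2 (Nom2 b)) \<in> accs \<Theta> \<Longrightarrow> At1 i (Dia1 (Nom1 j)) \<in> accs \<Theta> \<Longrightarrow>
    local_rule \<Theta> [[Inherited (At i a (Dia2 (Nom2 b)))]]"

text \<open>\<open>dia_rule \<Theta> \<chi> alts\<close>: a diamond rule applied to the premise \<open>\<chi>\<close>, with any fresh nominal.\<close>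

inductive dia_rule ::
    "('p, 'i, 'a) node set \<Rightarrow> ('p, 'i, 'a) fm \<Rightarrow> ('p, 'i, 'a) node list list \<Rightarrow> bool"
  for \<Theta> :: "('p, 'i, 'a) node set" where
  Dia1: "\<chi> = At i a (Dia1 \<phi>) \<Longrightarrow> \<chi> \<in> forms \<Theta> \<Longrightarrow> \<not> dia_applied \<Theta> \<chi> \<Longrightarrow> fresh1 \<Theta> j \<Longrightarrow>
    dia_rule \<Theta> \<chi> [[Witness (At1 i (Dia1 (Nom1 j))) \<chi>, Plain (At j a \<phi>)]]"
| Dia2: "\<chi> = At i a (Dia2 \<phi>) \<Longrightarrow> \<chi> \<in> forms \<Theta> - accs \<Theta> \<Longrightarrow> \<not> dia_applied \<Theta> \<chi> \<Longrightarrow> fresh2 \<Theta> b \<Longrightarrow>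
    dia_rule \<Theta> \<chi> [[Witness (At i a (Dia2 (Nom2 b))) \<chi>, Plain (At i b \<phi>)]]"

definition tab_rule :: "('p, 'i, 'a) node set \<Rightarrow> ('p, 'i, 'a) node list list \<Rightarrow> bool" where
  "tab_rule \<Theta> alts \<longleftrightarrow> local_rule \<Theta> alts \<or> (\<exists>\<chi>. dia_rule \<Theta> \<chi> alts)"

definition closed_branch :: "('p, 'i, 'a) node set \<Rightarrow> bool" where
  "closed_branch \<Theta> \<longleftrightarrow>
     (\<exists>\<phi> i a. At i a \<phi> \<in> forms \<Theta> \<and> At i a (Neg \<phi>) \<in> forms \<Theta>) \<or>
     (\<exists>\<phi> i. At1 i \<phi> \<in> forms \<Theta> \<and> At1 i (Neg \<phi>) \<in> forms \<Theta>) \<or>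
     (\<exists>\<phi> a. At2 a \<phi> \<in> forms \<Theta> \<and> At2 a (Neg \<phi>) \<in> forms \<Theta>)"

text \<open>
  No rule application yields anything new.  For the splitting rule it suffices that one of the
  alternatives is present.  The diamond rules are treated separately, without reference to fresh
  nominals, because an infinite branch may use up all nominals.
\<close>

definition saturated :: "('p, 'i, 'a) node set \<Rightarrow> bool" where
  "saturated \<Theta> \<longleftrightarrow>
     (\<forall>alts. local_rule \<Theta> alts \<longrightarrow> (\<exists>alt \<in> set alts. formula ` set alt \<subseteq> forms \<Theta>)) \<and>
     (\<forall>i a \<phi>. At i a (Dia1 \<phi>) \<in> forms \<Theta> \<longrightarrow> dia_applied \<Theta> (At i a (Dia1 \<phi>))) \<and>
     (\<forall>i a \<phi>. At i a (Dia2 \<phi>) \<in> forms \<Theta> - accs \<Theta> \<longrightarrow> dia_applied \<Theta> (At i a (Dia2 \<phi>)))"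

definition finished :: "('p, 'i, 'a) node set \<Rightarrow> bool" where
  "finished \<Theta> \<longleftrightarrow> closed_branch \<Theta> \<or> saturated \<Theta>"


section \<open>Tableaux\<close>

text \<open>Finitely branching trees, possibly of infinite height.\<close>

codatatype 'n tree = Node (label: 'n) (children: "'n tree list")

text \<open>A vertical chain of nodes with the trees \<open>ts\<close> below its last node.\<close>

primrec graft :: "'n list \<Rightarrow> 'n tree list \<Rightarrow> 'n tree list" where
  "graft [] ts = ts"
| "graft (n # ns) ts = [Node n (graft ns ts)]"

text \<open>
  \<open>extends \<Theta> ts\<close>: the forest \<open>ts\<close> arises by rule applications below a path whose set of nodes
  is \<open>\<Theta>\<close>.  That rules are applied as often as possible is not expressed here but by the condition
  on branches in \<open>tableau\<close>.
\<close>

coinductive extends :: "('p, 'i, 'a) node set \<Rightarrow> ('p, 'i, 'a) node tree list \<Rightarrow> bool" where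
  stop: "extends \<Theta> []"
| apply_rule: "\<not> finished \<Theta> \<Longrightarrow> tab_rule \<Theta> alts \<Longrightarrow>
    list_all2 (\<lambda>alt ts. extends (\<Theta> \<union> set alt) ts) alts tss \<Longrightarrow>
    extends \<Theta> (concat (map2 graft alts tss))"

text \<open>A maximal path from the root, as a sequence that is \<open>None\<close> after the end of a finite path.\<close>

definition maximal_path :: "'n tree \<Rightarrow> (nat \<Rightarrow> 'n tree option) \<Rightarrow> bool" where
  "maximal_path t \<beta> \<longleftrightarrow>
     \<beta> 0 = Some t \<and>
     (\<forall>n. case \<beta> n of
        None \<Rightarrow> \<beta> (Suc n) = None
      | Some u \<Rightarrow>
          (if children u = [] then \<beta> (Suc n) = None
           else \<exists>u' \<in> set (children u). \<beta> (Suc n) = Some u'))"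

definition branches :: "'n tree \<Rightarrow> 'n set set" where
  "branches t = {{label u |u. \<exists>n. \<beta> n = Some u} |\<beta>. maximal_path t \<beta>}"

definition tableau :: "('p, 'i, 'a) node tree \<Rightarrow> bool" where
  "tableau t \<longleftrightarrow>
     (\<exists>i a \<phi>. i \<notin> noms1 \<phi> \<and> a \<notin> noms2 \<phi> \<and> label t = Plain (At i a (Neg \<phi>))) \<and>
     extends {label t} (children t) \<and>
     (\<forall>\<Theta> \<in> branches t. finished \<Theta>)"

definition closed_tableau :: "('p, 'i, 'a) node tree \<Rightarrow> bool" where
  "closed_tableau t \<longleftrightarrow> tableau t \<and> (\<forall>\<Theta> \<in> branches t. closed_branch \<Theta>)"

definition provable :: "('p, 'i, 'a) fm \<Rightarrow> bool" where
  "provable \<phi> \<longleftrightarrow>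
     (\<exists>i a t. i \<notin> noms1 \<phi> \<and> a \<notin> noms2 \<phi> \<and> closed_tableau t \<and>
        formula (label t) = At i a (Neg \<phi>))"

end

theory Submission
  imports Defs
begin

text \<open>
  Soundness is proved by contraposition.  Suppose \<open>\<phi>\<close> fails at a point of some decreasing model.
  Reinterpreting the two root nominals, which do not occur in \<open>\<phi>\<close>, as the coordinates of that
  point yields a decreasing model of the root formula.  Now descend from the root, keeping the
  formulas met so far true in a decreasing model.  Every rule allows this to be continued
  into one of its alternatives: the rules that introduce no nominal keep the model
  (\<open>local_rule_sound\<close>), with \<open>[Dec]\<close> being the only one that needs the frame to be
  decreasing, while a diamond rule has its fresh nominal reinterpreted as a witnessing successor
  (\<open>dia_rule_sound\<close>).

  The model may thus change infinitely often along an infinite branch, and no model need exist in the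
  limit.  None is required: closure of a branch is caused by two formulas, hence by finitely many
  nodes, and these already lie on a finite initial segment, which does have a model
  (\<open>branch_with_consistent_segments\<close>).  So the branch found in this way is open.
\<close>

section \<open>Semantics in terms of denotations\<close>

lemma den1_eq:
  assumes "d_product_model M" "x \<in> worlds1 M" "val_nom1 M i = {x} \<times> worlds2 M"
  shows "den1 M i = x"
  unfolding den1_def
  using assms by (intro the_equality) (auto simp: d_product_model_def d_product_frame_def)

lemma den2_eq:
  assumes "d_product_model M" "y \<in> worlds2 M" "val_nom2 M a = worlds1 M \<times> {y}"
  shows "den2 M a = y"
  unfolding den2_def
  using assms by (intro the_equality) (auto simp: d_product_model_def d_product_frame_def)

lemma den1_props:
  assumes "d_product_model M"
  shows "den1 M i \<in> worlds1 M" and "val_nom1 M i = {den1 M i} \<times> worlds2 M"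
proof -
  obtain x where "x \<in> worlds1 M" "val_nom1 M i = {x} \<times> worlds2 M"
    using assms unfolding d_product_model_def by blast
  with den1_eq[OF assms this] show "den1 M i \<in> worlds1 M" "val_nom1 M i = {den1 M i} \<times> worlds2 M"
    by auto
qed

lemma den2_props:
  assumes "d_product_model M"
  shows "den2 M a \<in> worlds2 M" and "val_nom2 M a = worlds1 M \<times> {den2 M a}"
proof -
  obtain y where "y \<in> worlds2 M" "val_nom2 M a = worlds1 M \<times> {y}"
    using assms unfolding d_product_model_def by blast
  with den2_eq[OF assms this] show "den2 M a \<in> worlds2 M" "val_nom2 M a = worlds1 M \<times> {den2 M a}"
    by auto
qed

lemma sat_Dia1_iff:
  assumes "d_product_model M" "x \<in> worlds1 M" "y \<in> worlds2 M"
  shows "sat M (x, y) (Dia1 \<phi>) \<longleftrightarrow> (\<exists>x' \<in> worlds1 M. (x, x') \<in> rel1 M \<and> sat M (x', y) \<phi>)"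
  using assms by (auto simp: rel_h_def points_def)

lemma sat_Dia2_iff:
  assumes "d_product_model M" "x \<in> worlds1 M" "y \<in> worlds2 M"
  shows "sat M (x, y) (Dia2 \<phi>) \<longleftrightarrow> (\<exists>y' \<in> worlds2 M. (y, y') \<in> rel2 M x \<and> sat M (x, y') \<phi>)"
  using assms by (auto simp: rel_v_def points_def)

text \<open>This is why nominals foreign to a formula may be reinterpreted at will.\<close>

lemma sat_cong_nominals:
  assumes "worlds1 N = worlds1 M" "worlds2 N = worlds2 M" "rel1 N = rel1 M" "rel2 N = rel2 M"
    and "val_prop N = val_prop M"
    and "\<And>i. i \<in> noms1 \<phi> \<Longrightarrow> den1 N i = den1 M i"
    and "\<And>a. a \<in> noms2 \<phi> \<Longrightarrow> den2 N a = den2 M a"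
  shows "sat N w \<phi> \<longleftrightarrow> sat M w \<phi>"
proof -
  have "rel_h N = rel_h M" "rel_v N = rel_v M"
    using assms(1-4) by (simp_all add: rel_h_def rel_v_def points_def)
  then show ?thesis
    using assms(5-) by (induction \<phi> arbitrary: w) auto
qed


section \<open>Reinterpreting a nominal\<close>

definition set_den1 ::
    "('p, 'i, 'a, 'w, 'v) dmodel \<Rightarrow> 'i \<Rightarrow> 'w \<Rightarrow> ('p, 'i, 'a, 'w, 'v) dmodel" where
  "set_den1 M j x = M\<lparr>val_nom1 := (val_nom1 M)(j := {x} \<times> worlds2 M)\<rparr>"

definition set_den2 ::
    "('p, 'i, 'a, 'w, 'v) dmodel \<Rightarrow> 'a \<Rightarrow> 'v \<Rightarrow> ('p, 'i, 'a, 'w, 'v) dmodel" where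
  "set_den2 M b y = M\<lparr>val_nom2 := (val_nom2 M)(b := worlds1 M \<times> {y})\<rparr>"

lemma set_den1_simps [simp]:
  "worlds1 (set_den1 M j x) = worlds1 M" "worlds2 (set_den1 M j x) = worlds2 M"
  "rel1 (set_den1 M j x) = rel1 M" "rel2 (set_den1 M j x) = rel2 M"
  "val_prop (set_den1 M j x) = val_prop M" "points (set_den1 M j x) = points M"
  "decreasing (set_den1 M j x) = decreasing M" "den2 (set_den1 M j x) = den2 M"
  by (auto simp: set_den1_def points_def decreasing_def den2_def)

lemma set_den2_simps [simp]:
  "worlds1 (set_den2 M b y) = worlds1 M" "worlds2 (set_den2 M b y) = worlds2 M"
  "rel1 (set_den2 M b y) = rel1 M" "rel2 (set_den2 M b y) = rel2 M"
  "val_prop (set_den2 M b y) = val_prop M" "points (set_den2 M b y) = points M"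
  "decreasing (set_den2 M b y) = decreasing M" "den1 (set_den2 M b y) = den1 M"
  by (auto simp: set_den2_def points_def decreasing_def den1_def)

lemma d_product_model_set_den1:
  assumes "d_product_model M" "x \<in> worlds1 M"
  shows "d_product_model (set_den1 M j x)"
  using assms
  by (auto simp: d_product_model_def d_product_frame_def points_def set_den1_def)

lemma d_product_model_set_den2:
  assumes "d_product_model M" "y \<in> worlds2 M"
  shows "d_product_model (set_den2 M b y)"
  using assms
  by (auto simp: d_product_model_def d_product_frame_def points_def set_den2_def)

lemma den1_set_den1:
  assumes "d_product_model M" "x \<in> worlds1 M"
  shows "den1 (set_den1 M j x) = (den1 M)(j := x)"
proof
  fix i
  have "val_nom1 (set_den1 M j x) i = {((den1 M)(j := x)) i} \<times> worlds2 (set_den1 M j x)"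
    using den1_props(2)[OF assms(1)] by (simp add: set_den1_def)
  then show "den1 (set_den1 M j x) i = ((den1 M)(j := x)) i"
    using assms den1_props(1)[OF assms(1)]
    by (intro den1_eq d_product_model_set_den1) auto
qed

lemma den2_set_den2:
  assumes "d_product_model M" "y \<in> worlds2 M"
  shows "den2 (set_den2 M b y) = (den2 M)(b := y)"
proof
  fix a
  have "val_nom2 (set_den2 M b y) a = worlds1 (set_den2 M b y) \<times> {((den2 M)(b := y)) a}"
    using den2_props(2)[OF assms(1)] by (simp add: set_den2_def)
  then show "den2 (set_den2 M b y) a = ((den2 M)(b := y)) a"
    using assms den2_props(1)[OF assms(1)]
    by (intro den2_eq d_product_model_set_den2) auto
qed

lemma sat_set_den1:
  assumes "d_product_model M" "x \<in> worlds1 M" "j \<notin> noms1 \<phi>"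
  shows "sat (set_den1 M j x) w \<phi> \<longleftrightarrow> sat M w \<phi>"
  using assms by (intro sat_cong_nominals) (auto simp: den1_set_den1)

lemma sat_set_den2:
  assumes "d_product_model M" "y \<in> worlds2 M" "b \<notin> noms2 \<phi>"
  shows "sat (set_den2 M b y) w \<phi> \<longleftrightarrow> sat M w \<phi>"
  using assms by (intro sat_cong_nominals) (auto simp: den2_set_den2)


section \<open>Soundness of the rules\<close>

text \<open>
  The formulas on a branch all start with nominals that fix every coordinate they depend on, so
  that true somewhere and true everywhere amount to the same for them.
\<close>

definition globally_true ::
    "('p, 'i, 'a, 'w, 'v) dmodel \<Rightarrow> ('p, 'i, 'a) node set \<Rightarrow> bool" where
  "globally_true M \<Theta> \<longleftrightarrow> (\<forall>\<psi> \<in> forms \<Theta>. \<forall>w \<in> points M. sat M w \<psi>)"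

lemma globally_true_Un:
  "globally_true M (\<Theta> \<union> \<Theta>') \<longleftrightarrow> globally_true M \<Theta> \<and> globally_true M \<Theta>'"
  by (auto simp: globally_true_def forms_def)

lemma globally_true_mono: "\<Theta> \<subseteq> \<Theta>' \<Longrightarrow> globally_true M \<Theta>' \<Longrightarrow> globally_true M \<Theta>"
  by (auto simp: globally_true_def forms_def)

lemma den_point:
  assumes "d_product_model M"
  shows "(den1 M i, den2 M a) \<in> points M"
  using den1_props(1)[OF assms] den2_props(1)[OF assms] by (simp add: points_def)

lemma globally_trueD:
  assumes "d_product_model M" "globally_true M \<Theta>" "\<psi> \<in> forms \<Theta>"
  shows "sat M (den1 M i, den2 M a) \<psi>"
  using assms den_point[OF assms(1)] by (auto simp: globally_true_def)

lemma globally_true_At: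
  assumes "d_product_model M" "globally_true M \<Theta>" "At i a \<psi> \<in> forms \<Theta>"
  shows "sat M (den1 M i, den2 M a) \<psi>"
  using globally_trueD[OF assms, of i a] by simp

lemma globally_true_access1:
  assumes "d_product_model M" "globally_true M \<Theta>" "At1 i (Dia1 (Nom1 j)) \<in> forms \<Theta>"
  shows "(den1 M i, den1 M j) \<in> rel1 M"
  using globally_trueD[OF assms] by (auto simp: rel_h_def)

lemma globally_true_access2:
  assumes "d_product_model M" "globally_true M \<Theta>" "At i a (Dia2 (Nom2 b)) \<in> forms \<Theta>"
  shows "(den2 M a, den2 M b) \<in> rel2 M (den1 M i)"
  using globally_trueD[OF assms] by (auto simp: rel_v_def)

lemma globally_true_eq1:
  assumes "d_product_model M" "globally_true M \<Theta>" "At1 i (Nom1 j) \<in> forms \<Theta>"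
  shows "den1 M i = den1 M j"
  using globally_trueD[OF assms] by simp

lemma globally_true_eq2:
  assumes "d_product_model M" "globally_true M \<Theta>" "At2 a (Nom2 b) \<in> forms \<Theta>"
  shows "den2 M a = den2 M b"
  using globally_trueD[OF assms] by simp

lemma accs_subset_forms: "accs \<Theta> \<subseteq> forms \<Theta>"
  by (auto simp: accs_def forms_def)

lemma globally_true_iff:
  "globally_true M \<Theta> \<longleftrightarrow> (\<forall>n \<in> \<Theta>. \<forall>w \<in> points M. sat M w (formula n))"
  by (auto simp: globally_true_def forms_def)

text \<open>
  Each premise speaks about the denotations of its nominals, so each rule is a step between facts
  about the same worlds of the given model.  In the case of \<open>[Dec]\<close>, the step is \<open>R\<^sub>2(j) \<subseteq> R\<^sub>2(i)\<close> for \<open>i R\<^sub>1 j\<close>, that is, the decreasing condition itself.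
\<close>

lemma local_rule_sound:
  assumes M: "d_product_model M" and dec: "decreasing M" and \<Theta>: "globally_true M \<Theta>"
    and rule: "local_rule \<Theta> alts"
  shows "\<exists>alt \<in> set alts. globally_true M (\<Theta> \<union> set alt)"
proof -
  note At = globally_true_At[OF M \<Theta>] and all = globally_trueD[OF M \<Theta>]
  note den = den1_props(1)[OF M] den2_props(1)[OF M]
  have "\<exists>alt \<in> set alts. globally_true M (set alt)"
    using rule
  proof cases
    case (NegDia1 i a \<phi> j)
    then show ?thesis
      using At[of i a "Neg (Dia1 \<phi>)"] globally_true_access1[OF M \<Theta>, of i j] den
      by (auto simp: globally_true_iff sat_Dia1_iff[OF M] simp del: sat.simps(6))
  next
    case (NegDia2 i a \<phi> b)
    then show ?thesis
      using At[of i a "Neg (Dia2 \<phi>)"] globally_true_access2[OF M \<Theta>, of i a b] den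
      by (auto simp: globally_true_iff sat_Dia2_iff[OF M] simp del: sat.simps(7))
  next
    case (Id1 i a \<phi> j)
    then show ?thesis
      using At[of i a \<phi>] globally_true_eq1[OF M \<Theta>, of i j] by (auto simp: globally_true_iff)
  next
    case (Id2 i a \<phi> b)
    then show ?thesis
      using At[of i a \<phi>] globally_true_eq2[OF M \<Theta>, of a b] by (auto simp: globally_true_iff)
  next
    case (Id1' i s j)
    then show ?thesis
      using all[of "At1 i s"] globally_true_eq1[OF M \<Theta>, of i j]
      by (auto simp: globally_true_iff nom1_literal_def)
  next
    case (Id2' a t b)
    then show ?thesis
      using all[of "At2 a t"] globally_true_eq2[OF M \<Theta>, of a b]
      by (auto simp: globally_true_iff nom2_literal_def)
  next
    case (Dec j a b i)
    then have "(den2 M a, den2 M b) \<in> rel2 M (den1 M j)" "(den1 M i, den1 M j) \<in> rel1 M"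
      using accs_subset_forms[of \<Theta>] globally_true_access1[OF M \<Theta>] globally_true_access2[OF M \<Theta>]
      by blast+
    then have "(den2 M a, den2 M b) \<in> rel2 M (den1 M i)"
      using dec den unfolding decreasing_def by blast
    then show ?thesis
      using Dec den
      by (auto simp: globally_true_iff sat_Dia2_iff[OF M] simp del: sat.simps(7))
  qed (auto simp: globally_true_iff nom1_literal_def nom2_literal_def dest!: At)
  then show ?thesis
    using \<Theta> by (auto simp: globally_true_Un)
qed

text \<open>
  Making the new nominal denote a successor that witnesses the diamond does not affect the truth of
  the formulas already present, because it is fresh for them.
\<close>

lemma dia_rule_sound:
  fixes M :: "('p, 'i, 'a, 'w, 'v) dmodel"
  assumes M: "d_product_model M" and dec: "decreasing M" and \<Theta>: "globally_true M \<Theta>"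
    and rule: "dia_rule \<Theta> \<chi> alts"
  shows "\<exists>alt \<in> set alts. \<exists>N :: ('p, 'i, 'a, 'w, 'v) dmodel.
    d_product_model N \<and> decreasing N \<and> globally_true N (\<Theta> \<union> set alt)"
  using rule
proof cases
  case (Dia1 i a \<phi> j)
  obtain x where x: "x \<in> worlds1 M" "(den1 M i, x) \<in> rel1 M" "sat M (x, den2 M a) \<phi>"
    using globally_true_At[OF M \<Theta>, of i a "Dia1 \<phi>"] Dia1
      sat_Dia1_iff[OF M den1_props(1)[OF M] den2_props(1)[OF M]] by blast
  let ?N = "set_den1 M j x"
  have N: "d_product_model ?N" and den: "den1 ?N = (den1 M)(j := x)"
    using M x(1) by (simp_all add: d_product_model_set_den1 den1_set_den1)
  have j: "j \<noteq> i" "j \<notin> noms1 \<phi>"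
    using Dia1 by (auto simp: fresh1_def)
  have "globally_true ?N \<Theta>"
    using \<Theta> Dia1 M x(1) by (auto simp: globally_true_def fresh1_def sat_set_den1)
  moreover have "globally_true ?N
      (set [Witness (At1 i (Dia1 (Nom1 j))) \<chi>, Plain (At j a \<phi>)])"
    using x j M den1_props(1)[OF M, of i] den
    by (auto simp: globally_true_iff sat_set_den1 rel_h_def points_def)
  ultimately show ?thesis
    using N dec Dia1 by (intro bexI exI[of _ ?N]) (auto simp: globally_true_iff)
next
  case (Dia2 i a \<phi> b)
  obtain y where y: "y \<in> worlds2 M" "(den2 M a, y) \<in> rel2 M (den1 M i)" "sat M (den1 M i, y) \<phi>"
    using globally_true_At[OF M \<Theta>, of i a "Dia2 \<phi>"] Dia2
      sat_Dia2_iff[OF M den1_props(1)[OF M] den2_props(1)[OF M]] by blast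
  let ?N = "set_den2 M b y"
  have N: "d_product_model ?N" and den: "den2 ?N = (den2 M)(b := y)"
    using M y(1) by (simp_all add: d_product_model_set_den2 den2_set_den2)
  have b: "b \<noteq> a" "b \<notin> noms2 \<phi>"
    using Dia2 by (auto simp: fresh2_def)
  have "globally_true ?N \<Theta>"
    using \<Theta> Dia2 M y(1) by (auto simp: globally_true_def fresh2_def sat_set_den2)
  moreover have "globally_true ?N
      (set [Witness (At i a (Dia2 (Nom2 b))) \<chi>, Plain (At i b \<phi>)])"
    using y b M den1_props(1)[OF M, of i] den2_props(1)[OF M, of a] den
    by (auto simp: globally_true_iff sat_set_den2 rel_v_def points_def)
  ultimately show ?thesis
    using N dec Dia2 by (intro bexI exI[of _ ?N]) (auto simp: globally_true_iff)
qed

lemma tab_rule_alternatives_nonempty: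
  "tab_rule \<Theta> alts \<Longrightarrow> alt \<in> set alts \<Longrightarrow> alt \<noteq> []"
  by (auto simp: tab_rule_def elim!: local_rule.cases dia_rule.cases)

lemma closed_branch_not_globally_true:
  assumes M: "d_product_model M" and "closed_branch \<Theta>"
  shows "\<not> globally_true M \<Theta>"
proof
  assume \<Theta>: "globally_true M \<Theta>"
  obtain w where "w \<in> points M"
    using den_point[OF M] by blast
  with \<Theta> have all: "sat M w \<psi>" if "\<psi> \<in> forms \<Theta>" for \<psi>
    using that by (auto simp: globally_true_def)
  show False
    using \<open>closed_branch \<Theta>\<close> unfolding closed_branch_def
    by (elim disjE exE conjE) (drule all, drule all, simp)+
qed


section \<open>Branches whose finite parts are consistent\<close>

text \<open>
  One rule application may add a chain of several nodes, so a descent into the tree is at times in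
  the midst of such a chain.  The list \<open>ns\<close> is what remains of it, and \<open>ts'\<close> is what lies below.
\<close>

definition promising ::
    "(('p, 'i, 'a) node set \<Rightarrow> bool) \<Rightarrow> ('p, 'i, 'a) node set \<Rightarrow> ('p, 'i, 'a) node tree list \<Rightarrow> bool"
  where
  "promising S A ts \<longleftrightarrow>
     (\<exists>ns ts'. set (graft ns ts') \<subseteq> set ts \<and> (ns = [] \<longrightarrow> ts' = ts) \<and>
        extends (A \<union> set ns) ts' \<and> S (A \<union> set ns))"

lemma promising_step:
  assumes rules: "\<And>\<Theta> alts. S \<Theta> \<Longrightarrow> tab_rule \<Theta> alts \<Longrightarrow> \<exists>alt \<in> set alts. S (\<Theta> \<union> set alt)"
    and "promising S A ts" and "ts \<noteq> []"
  shows "\<exists>u \<in> set ts. promising S (insert (label u) A) (children u)"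
proof -
  have "\<exists>ns ts'. ns \<noteq> [] \<and> set (graft ns ts') \<subseteq> set ts \<and> extends (A \<union> set ns) ts' \<and> S (A \<union> set ns)"
  proof -
    obtain ns ts' where ns: "set (graft ns ts') \<subseteq> set ts" "ns = [] \<longrightarrow> ts' = ts"
      "extends (A \<union> set ns) ts'" "S (A \<union> set ns)"
      using assms(2) unfolding promising_def by blast
    show ?thesis
    proof (cases "ns = []")
      case True
      then have "extends A ts" "S A"
        using ns by auto
      from this(1) show ?thesis
      proof cases
        case stop
        with \<open>ts \<noteq> []\<close> show ?thesis by simp
      next
        case (apply_rule alts tss)
        obtain k where k: "k < length alts" "S (A \<union> set (alts ! k))"
          using rules[OF \<open>S A\<close> apply_rule(3)] by (auto simp: in_set_conv_nth)
        have "k < length tss" "extends (A \<union> set (alts ! k)) (tss ! k)"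
          using apply_rule(4) k(1) by (auto simp: list_all2_conv_all_nth)
        moreover have "set (graft (alts ! k) (tss ! k)) \<subseteq> set ts"
        proof -
          have "map2 graft alts tss ! k \<in> set (map2 graft alts tss)"
            using k(1) \<open>k < length tss\<close> by (intro nth_mem) simp
          then have "graft (alts ! k) (tss ! k) \<in> set (map2 graft alts tss)"
            using k(1) \<open>k < length tss\<close> by simp
          then show ?thesis
            unfolding apply_rule(1) set_concat by blast
        qed
        moreover have "alts ! k \<noteq> []"
          using tab_rule_alternatives_nonempty[OF apply_rule(3)] k(1) by simp
        ultimately show ?thesis
          using k(2) by blast
      qed
    next
      case False
      with ns show ?thesis by blast
    qed
  qed
  then obtain ns ts' where ns: "ns \<noteq> []" "set (graft ns ts') \<subseteq> set ts"
    "extends (A \<union> set ns) ts'" "S (A \<union> set ns)"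
    by blast
  obtain n ns' where "ns = n # ns'"
    using ns(1) by (cases ns) auto
  with ns have n: "Node n (graft ns' ts') \<in> set ts"
    "extends (insert n A \<union> set ns') ts'" "S (insert n A \<union> set ns')"
    by simp_all
  have "promising S (insert n A) (graft ns' ts')"
    unfolding promising_def
    by (rule exI[of _ ns'], rule exI[of _ ts']) (use n(2,3) in simp)
  with n(1) show ?thesis
    by (intro bexI[of _ "Node n (graft ns' ts')"]) simp_all
qed

text \<open>
  At each rule application the descent chooses an alternative that preserves \<open>S\<close>.  This makes \<open>S\<close>
  hold of all initial segments of the resulting branch, and every finite part of the branch lies in
  one of them.  The conclusion cannot be extended to the whole branch, because \<open>S\<close> need not be
  closed under unions of chains.
\<close>

lemma branch_with_consistent_segments:
  fixes S :: "('p, 'i, 'a) node set \<Rightarrow> bool"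
  assumes rules: "\<And>\<Theta> alts. S \<Theta> \<Longrightarrow> tab_rule \<Theta> alts \<Longrightarrow> \<exists>alt \<in> set alts. S (\<Theta> \<union> set alt)"
    and mono: "\<And>A B. A \<subseteq> B \<Longrightarrow> S B \<Longrightarrow> S A"
    and root: "S {label t}" and ext: "extends {label t} (children t)"
  shows "\<exists>\<Theta> \<in> branches t. \<forall>A \<subseteq> \<Theta>. finite A \<longrightarrow> S A"
proof -
  let ?next = "\<lambda>v v'. case v of None \<Rightarrow> v' = None
      | Some u \<Rightarrow> (if children u = [] then v' = None else \<exists>u' \<in> set (children u). v' = Some u')"
  \<comment> \<open>A state consists of the nodes met so far and the current position.\<close>
  define P where "P = (\<lambda>n (A, v). S A \<and> (n = (0::nat) \<longrightarrow> v = Some t) \<and>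
    (\<forall>u. v = Some u \<longrightarrow> label u \<in> A \<and> promising S A (children u)))"
  define Q where "Q = (\<lambda>(n :: nat) (A :: ('p, 'i, 'a) node set, v) (A', v' :: ('p, 'i, 'a) node tree option). A \<subseteq> A' \<and> ?next v v')"
  have promisingD: "S A" if "promising S A ts" for A ts
    using that mono unfolding promising_def by blast
  have "\<exists>s. P 0 s"
  proof
    have "promising S {label t} (children t)"
      unfolding promising_def by (rule exI[of _ "[]"]) (use root ext in simp)
    then show "P 0 ({label t}, Some t)"
      using root by (simp add: P_def)
  qed
  moreover have "\<exists>s'. P (Suc n) s' \<and> Q n s s'" if "P n s" for n s
  proof -
    obtain A v where s: "s = (A, v)" by (cases s)
    show ?thesis
    proof (cases "\<exists>u. v = Some u \<and> children u \<noteq> []")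
      case True
      then obtain u where u: "v = Some u" "children u \<noteq> []" by blast
      then have "promising S A (children u)"
        using that s by (simp add: P_def)
      from promising_step[OF rules this u(2)]
      obtain u' where u': "u' \<in> set (children u)"
        "promising S (insert (label u') A) (children u')" by blast
      then show ?thesis
        using s u promisingD
        by (intro exI[of _ "(insert (label u') A, Some u')"]) (auto simp: P_def Q_def)
    next
      case False
      then show ?thesis
        using s that
        by (intro exI[of _ "(A, None)"]) (auto simp: P_def Q_def split: option.splits)
    qed
  qed
  ultimately obtain f where f: "\<And>n. P n (f n)" "\<And>n. Q n (f n) (f (Suc n))"
    using dependent_nat_choice[of P Q] by metis
  define C where "C n = fst (f n)" for n
  define \<beta> where "\<beta> n = snd (f n)" for n
  have SC: "S (C n)" for n
    using f(1)[of n] by (auto simp: P_def C_def)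
  have label_C: "label u \<in> C n" if "\<beta> n = Some u" for n u
    using f(1)[of n] that by (auto simp: P_def C_def \<beta>_def)
  have "incseq C"
  proof (intro incseq_SucI)
    show "C n \<subseteq> C (Suc n)" for n
      using f(2)[of n] by (simp add: Q_def C_def case_prod_beta)
  qed
  have "\<beta> 0 = Some t"
    using f(1)[of 0] by (auto simp: P_def \<beta>_def)
  moreover have "?next (\<beta> n) (\<beta> (Suc n))" for n
    using f(2)[of n] unfolding Q_def \<beta>_def case_prod_beta by (rule conjunct2)
  ultimately have "maximal_path t \<beta>"
    unfolding maximal_path_def by blast
  then have "{label u |u. \<exists>n. \<beta> n = Some u} \<in> branches t"
    unfolding branches_def by blast
  moreover have "S A" if "A \<subseteq> {label u |u. \<exists>n. \<beta> n = Some u}" "finite A" for A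
  proof -
    have "\<exists>n. A \<subseteq> C n"
      using that(2,1)
    proof (induction A)
      case empty
      then show ?case by simp
    next
      case (insert x A)
      then obtain m n where "A \<subseteq> C m" "x \<in> C n"
        using label_C by auto
      then have "insert x A \<subseteq> C (max m n)"
        using incseqD[OF \<open>incseq C\<close>, of m "max m n"] incseqD[OF \<open>incseq C\<close>, of n "max m n"] by auto
      then show ?case by blast
    qed
    with SC mono show ?thesis by blast
  qed
  ultimately show ?thesis by blast
qed

lemma closed_branch_finite_part:
  assumes "closed_branch \<Theta>"
  shows "\<exists>A \<subseteq> \<Theta>. finite A \<and> closed_branch A"
proof -
  have "\<exists>A \<subseteq> \<Theta>. finite A \<and> \<psi> \<in> forms A \<and> \<chi> \<in> forms A"
    if clash: "\<psi> \<in> forms \<Theta>" "\<chi> \<in> forms \<Theta>" for \<psi> \<chi>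
  proof -
    obtain m n where "m \<in> \<Theta>" "formula m = \<psi>" "n \<in> \<Theta>" "formula n = \<chi>"
      using clash by (auto simp: forms_def)
    then show ?thesis
      by (intro exI[of _ "{m, n}"]) (auto simp: forms_def)
  qed
  with assms show ?thesis
    unfolding closed_branch_def by meson
qed


section \<open>Soundness of the calculus\<close>

theorem theorem6p16:
  fixes \<phi> :: "('p::countable, 'i::{countable,infinite}, 'a::{countable,infinite}) fm"
    and M :: "('p, 'i, 'a, 'w, 'v) dmodel"
  assumes "provable \<phi>"
    and "d_product_model M"
    and "decreasing M"
    and "w \<in> points M"
  shows "sat M w \<phi>"
proof (rule ccontr)
  assume refuted: "\<not> sat M w \<phi>"
  obtain x y where w: "w = (x, y)" "x \<in> worlds1 M" "y \<in> worlds2 M"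
    using assms(4) by (auto simp: points_def)
  obtain i a t where fresh: "i \<notin> noms1 \<phi>" "a \<notin> noms2 \<phi>"
    and closed: "closed_tableau t" and label: "formula (label t) = At i a (Neg \<phi>)"
    using assms(1) unfolding provable_def by blast
  define S where "S = (\<lambda>\<Theta> :: ('p, 'i, 'a) node set. \<exists>N :: ('p, 'i, 'a, 'w, 'v) dmodel.
    d_product_model N \<and> decreasing N \<and> globally_true N \<Theta>)"
  have root: "S {label t}"
  proof -
    let ?M = "set_den1 M i x"
    let ?N = "set_den2 ?M a y"
    have M': "d_product_model ?M" and N: "d_product_model ?N"
      using assms(2) w by (simp_all add: d_product_model_set_den1 d_product_model_set_den2)
    have "den1 ?N i = x" "den2 ?N a = y"
      using assms(2) M' w by (simp_all add: den1_set_den1 den2_set_den2)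
    moreover have "\<not> sat ?N w \<phi>"
      using refuted fresh assms(2) M' w by (simp add: sat_set_den1 sat_set_den2)
    ultimately have "globally_true ?N {label t}"
      using label w by (simp add: globally_true_def forms_def)
    then show ?thesis
      unfolding S_def using N assms(3) by (intro exI[of _ ?N]) simp
  qed
  have rules: "\<exists>alt \<in> set alts. S (\<Theta> \<union> set alt)"
    if "S \<Theta>" "tab_rule \<Theta> alts" for \<Theta> alts
    using that local_rule_sound dia_rule_sound unfolding S_def tab_rule_def by meson
  have mono: "S A" if "A \<subseteq> B" "S B" for A B
    using that globally_true_mono unfolding S_def by blast
  have "extends {label t} (children t)"
    using closed by (simp add: closed_tableau_def tableau_def)
  with rules mono root have "\<exists>\<Theta> \<in> branches t. \<forall>A \<subseteq> \<Theta>. finite A \<longrightarrow> S A"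
    by (rule branch_with_consistent_segments)
  then obtain \<Theta> where \<Theta>: "\<Theta> \<in> branches t" "\<And>A. A \<subseteq> \<Theta> \<Longrightarrow> finite A \<Longrightarrow> S A"
    by blast
  from \<Theta>(1) closed have "closed_branch \<Theta>"
    by (simp add: closed_tableau_def)
  then obtain A where "A \<subseteq> \<Theta>" "finite A" "closed_branch A"
    using closed_branch_finite_part by blast
  with \<Theta>(2) show False
    using closed_branch_not_globally_true unfolding S_def by blast
qed

end
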